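(* Let $n\ge1$. For $T\in E_n$, the following are equivalent: (i) $T$ is multiplication-generated; (ii) $p(T)=e_n$; (iii) $C_T=0$. Equivalently, $$\mathcal M_n=\{T\in E_n: p(T)=e_n\}=\{T\in E_n: C_T=0\}.$$
   Context: $\Delta_n=\{i,j,k,e\}^n$ is the set of words $b=b_1b_2\cdots b_n$ of length $n$ in the four symbols $i,j,k,e$. Put $v(i)=(\cos 210^\circ,\sin 210^\circ)$, $v(j)=(\cos 90^\circ,\sin 90^\circ)$, $v(k)=(\cos 330^\circ,\sin 330^\circ)$, $v(e)=(0,0)$ in $\mathbb R^2$. Fix a real $d_1>0$ and put $d_r=d_1/2^{r-1}$. The centroid map $P:\Delta_n\to\mathbb R^2$ is $$P(b)=\sum_{r=1}^n \sigma_r(b)\,d_r\,v(b_r),\qquad \sigma_r(b)=(-1)^{\#\{s<r:\ b_s=e\}}.$$ $E_n$ is the set of unordered triples $\{b_1,b_2,b_3\}$ of distinct words in $\Delta_n$ such that $P(b_1),P(b_2),P(b_3)$ are the vertices of a nondegenerate equilateral triangle. Words are multiplied coordinatewise as quaternions ($e$ the identity, $i^2=j^2=k^2=-e$, $ij=k$, $jk=i$, $ki=j$, distinct elements of $\{i,j,k\}$ anticommute), with local signs collected into one global sign, giving an element of the group $\{\pm b:b\in\Delta_n\}$ with identity $e_n=ee\cdots e$; let $u(\pm b)=b$ for $b\in\Delta_n$. Any two words commute or anticommute, so for $T=\{b_1,b_2,b_3\}\in E_n$ the word $p(T)=u(b_1b_2b_3)$ is well defined. The product point of $T$ is $C_T=P(p(T))\in\mathbb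 R^2$. $T\in E_n$ is multiplication-generated if its vertices can be written $T=\{b,c,u(bc)\}$ with $b,c\in\Delta_n$; $\mathcal M_n$ denotes the set of multiplication-generated $T\in E_n$. *)

theory Defs
  imports "HOL-Analysis.Analysis"
begin

datatype letter = qi | qj | qk | qe

definition words :: "nat \<Rightarrow> letter list set" where
  "words n = {b. length b = n}"

definition id_word :: "nat \<Rightarrow> letter list" where
  "id_word n = replicate n qe"

definition unit_deg :: "real \<Rightarrow> real \<times> real" where
  "unit_deg t = (cos (t * pi / 180), sin (t * pi / 180))"

fun dir :: "letter \<Rightarrow> real \<times> real" where
  "dir qi = unit_deg 210"
| "dir qj = unit_deg 90"
| "dir qk = unit_deg 330"
| "dir qe = (0, 0)"

text \<open>Positions in a word are counted from 0 here, so position \<open>r\<close> is the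
  \<open>(r+1)\<close>-st letter and carries the scale \<open>d\<^sub>1 / 2 ^ r\<close>.\<close>

definition alt_sign :: "letter list \<Rightarrow> nat \<Rightarrow> real" where
  "alt_sign b r = (- 1) ^ card {s. s < r \<and> b ! s = qe}"

definition centroid :: "real \<Rightarrow> letter list \<Rightarrow> real \<times> real" where
  "centroid d1 b = (\<Sum>r<length b. (alt_sign b r * (d1 / 2 ^ r)) *\<^sub>R dir (b ! r))"

definition equilateral :: "'a::metric_space \<Rightarrow> 'a \<Rightarrow> 'a \<Rightarrow> bool" where
  "equilateral x y z \<longleftrightarrow> x \<noteq> y \<and> dist x y = dist y z \<and> dist y z = dist z x"

definition eq_triples :: "real \<Rightarrow> nat \<Rightarrow> letter list set set" where
  "eq_triples d1 n = {T. \<exists>b1\<in>words n. \<exists>b2\<in>words n. \<exists>b3\<in>words n.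
     distinct [b1, b2, b3] \<and> T = {b1, b2, b3} \<and>
     equilateral (centroid d1 b1) (centroid d1 b2) (centroid d1 b3)}"

text \<open>A signed letter or word is a pair of a sign in \<open>{1, -1}\<close> and the underlying
  letter or word.\<close>

fun lmult :: "letter \<Rightarrow> letter \<Rightarrow> int \<times> letter" where
  "lmult qe y = (1, y)"
| "lmult x qe = (1, x)"
| "lmult qi qi = (-1, qe)"
| "lmult qj qj = (-1, qe)"
| "lmult qk qk = (-1, qe)"
| "lmult qi qj = (1, qk)"
| "lmult qj qk = (1, qi)"
| "lmult qk qi = (1, qj)"
| "lmult qj qi = (-1, qk)"
| "lmult qk qj = (-1, qi)"
| "lmult qi qk = (-1, qj)"

type_synonym sword = "int \<times> letter list"

definition pos :: "letter list \<Rightarrow> sword" where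
  "pos b = (1, b)"

definition unsign :: "sword \<Rightarrow> letter list" where
  "unsign x = snd x"

fun wmult :: "sword \<Rightarrow> sword \<Rightarrow> sword" (infixl "\<odot>" 70) where
  "(s, b) \<odot> (t, c) =
     (s * t * prod_list (map2 (\<lambda>x y. fst (lmult x y)) b c), map2 (\<lambda>x y. snd (lmult x y)) b c)"

text \<open>\<open>prod_word_eq\<close> below shows that the word does not depend on the order in which
  the three words are multiplied, so the description is proper on triples of
  distinct words of equal length.\<close>

definition prod_word :: "letter list set \<Rightarrow> letter list" where
  "prod_word T = (THE w. \<exists>b1 b2 b3. distinct [b1, b2, b3] \<and> T = {b1, b2, b3} \<and>
     w = unsign (pos b1 \<odot> pos b2 \<odot> pos b3))"

definition product_point :: "real \<Rightarrow> letter list set \<Rightarrow> real \<times> real" where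
  "product_point d1 T = centroid d1 (prod_word T)"

definition mult_generated :: "nat \<Rightarrow> letter list set \<Rightarrow> bool" where
  "mult_generated n T \<longleftrightarrow> (\<exists>b\<in>words n. \<exists>c\<in>words n. T = {b, c, unsign (pos b \<odot> pos c)})"

definition mult_triples :: "real \<Rightarrow> nat \<Rightarrow> letter list set set" where
  "mult_triples d1 n = {T \<in> eq_triples d1 n. mult_generated n T}"

lemma wmult_assoc:
  assumes "length as = length bs" "length bs = length cs"
  shows "((s, as) \<odot> (t, bs)) \<odot> (u, cs) = (s, as) \<odot> ((t, bs) \<odot> (u, cs))"
proof -
  let ?f = "\<lambda>x y. fst (lmult x y)" and ?g = "\<lambda>x y. snd (lmult x y)"
  have g: "?g (?g a b) c = ?g a (?g b c)"
    and f: "?f a b * ?f (?g a b) c = ?f b c * ?f a (?g b c)" for a b c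
    by (cases a; cases b; cases c; simp)+
  have "map2 ?g (map2 ?g as bs) cs = map2 ?g as (map2 ?g bs cs) \<and>
    prod_list (map2 ?f as bs) * prod_list (map2 ?f (map2 ?g as bs) cs) =
    prod_list (map2 ?f bs cs) * prod_list (map2 ?f as (map2 ?g bs cs))"
    using assms
  proof (induction as bs cs rule: list_induct3)
    case (Cons a as b bs c cs)
    let ?L = "prod_list (map2 ?f as bs)" and ?L' = "prod_list (map2 ?f (map2 ?g as bs) cs)"
    let ?R = "prod_list (map2 ?f bs cs)" and ?R' = "prod_list (map2 ?f as (map2 ?g bs cs))"
    have "(?f a b * ?L) * (?f (?g a b) c * ?L') = (?f a b * ?f (?g a b) c) * (?L * ?L')"
      by (simp only: mult_ac)
    also have "\<dots> = (?f b c * ?f a (?g b c)) * (?R * ?R')"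
      using Cons.IH by (simp only: f)
    also have "\<dots> = (?f b c * ?R) * (?f a (?g b c) * ?R')"
      by (simp only: mult_ac)
    finally show ?case using Cons.IH g by simp
  qed simp
  then show ?thesis by (simp add: mult.assoc mult.left_commute)
qed

lemma wmult_commute_or_anticommute:
  "snd (pos b \<odot> pos c) = snd (pos c \<odot> pos b) \<and>
   (fst (pos b \<odot> pos c) = fst (pos c \<odot> pos b) \<or> fst (pos b \<odot> pos c) = - fst (pos c \<odot> pos b))"
proof -
  have g: "snd (lmult x y) = snd (lmult y x)"
    and f: "fst (lmult x y) = fst (lmult y x) \<or> fst (lmult x y) = - fst (lmult y x)" for x y
    by (cases x; cases y; simp)+
  show ?thesis unfolding pos_def
  proof (induction b c rule: list_induct2')
    case (4 x xs y ys)
    then show ?case using g[of x y] f[of x y] by auto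
  qed simp_all
qed

lemma unsign_wmult_commute: "unsign (x \<odot> y) = unsign (y \<odot> x)"
proof -
  have "snd (lmult a b) = snd (lmult b a)" for a b by (cases a; cases b; simp)
  then have "map2 (\<lambda>x y. snd (lmult x y)) bs cs = map2 (\<lambda>x y. snd (lmult x y)) cs bs" for bs cs
    by (induction bs cs rule: list_induct2') auto
  then show ?thesis by (cases x; cases y; simp add: unsign_def)
qed

lemma prod_word_eq:
  assumes "b1 \<in> words n" "b2 \<in> words n" "b3 \<in> words n" "distinct [b1, b2, b3]"
  shows "prod_word {b1, b2, b3} = unsign (pos b1 \<odot> pos b2 \<odot> pos b3)"
proof -
  let ?u = "\<lambda>x y z. unsign (pos x \<odot> pos y \<odot> pos z)"
  have c12: "?u x y z = ?u y x z" for x y z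
    using unsign_wmult_commute[of "pos x" "pos y"] by (simp add: unsign_def pos_def)
  have c23: "?u x y z = ?u x z y" if "x \<in> words n" "y \<in> words n" "z \<in> words n" for x y z
  proof -
    have "?u x y z = unsign (pos x \<odot> (pos y \<odot> pos z))"
      using that wmult_assoc[of x y z 1 1 1] by (simp only: pos_def words_def mem_Collect_eq)
    also have "\<dots> = unsign (pos x \<odot> (pos z \<odot> pos y))"
      using unsign_wmult_commute[of "pos y" "pos z"] by (simp add: unsign_def pos_def)
    also have "\<dots> = ?u x z y"
      using that wmult_assoc[of x z y 1 1 1] by (simp only: pos_def words_def mem_Collect_eq)
    finally show ?thesis .
  qed
  show ?thesis unfolding prod_word_def
  proof (rule the_equality)
    fix w assume "\<exists>a b c. distinct [a, b, c] \<and> {b1, b2, b3} = {a, b, c} \<and> w = ?u a b c"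
    then obtain a b c where h: "distinct [a, b, c]" "{b1, b2, b3} = {a, b, c}" "w = ?u a b c"
      by blast
    have "a \<in> {b1, b2, b3}" "b \<in> {b1, b2, b3}" "c \<in> {b1, b2, b3}" using h(2) by simp_all
    then consider "a = b1" "b = b2" "c = b3" | "a = b1" "b = b3" "c = b2"
      | "a = b2" "b = b1" "c = b3" | "a = b2" "b = b3" "c = b1"
      | "a = b3" "b = b1" "c = b2" | "a = b3" "b = b2" "c = b1"
      using h(1) by auto
    then have "?u a b c = ?u b1 b2 b3"
    proof cases
      case 1 then show ?thesis by (simp only:)
    next
      case 2 then show ?thesis using c23[of b1 b2 b3] assms by (simp only:)
    next
      case 3 then show ?thesis using c12[of b1 b2 b3] by (simp only:)
    next
      case 4 then show ?thesis using c23[of b2 b3 b1] c12[of b1 b2 b3] assms by (simp only:)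
    next
      case 5 then show ?thesis using c12[of b3 b1 b2] c23[of b1 b2 b3] assms by (simp only:)
    next
      case 6 then show ?thesis
        using c12[of b3 b2 b1] c23[of b2 b3 b1] c12[of b1 b2 b3] assms by (simp only:)
    qed
    then show "w = ?u b1 b2 b3" using h(3) by (simp only:)
  qed (use assms in blast)
qed

end

theory Submission
  imports Defs
begin

text \<open>
  The argument has an algebraic half and a metric half.

  Modulo signs, the letters form the Klein four-group with identity \<open>qe\<close>, so words of
  length \<open>n\<close> form a group of exponent two.  Hence three words multiply to the identity exactly
  if one of them is the product of the other two, which is the condition of being
  multiplication-generated (\<open>product_eq_id_word_iff\<close>).

  The only word with centroid \<open>0\<close> is the identity word (\<open>centroid_eq_0_iff\<close>): if \<open>r\<close> is the
  first position whose letter is not \<open>qe\<close>, then that letter contributes a vector of length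
  \<open>d1 / 2 ^ r\<close>, while all later letters together contribute strictly less, because a
  finite sum \<open>1/2 + 1/4 + \<dots>\<close> stays below \<open>1\<close>.
\<close>

lemma norm_dir: "norm (dir x) = (if x = qe then 0 else 1)"
  by (cases x) (simp_all add: unit_deg_def norm_Pair)

lemma alt_sign_0: "alt_sign b 0 = 1"
  by (simp add: alt_sign_def)

lemma alt_sign_Cons_Suc:
  "alt_sign (a # b) (Suc r) = (if a = qe then - 1 else 1) * alt_sign b r"
proof -
  have shift: "{s. s < Suc r \<and> (a # b) ! s = qe}
      = (if a = qe then {0} else {}) \<union> Suc ` {s. s < r \<and> b ! s = qe}" (is "?L = ?R")
  proof (rule set_eqI)
    fix s show "s \<in> ?L \<longleftrightarrow> s \<in> ?R" by (cases s) auto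
  qed
  show ?thesis
    unfolding alt_sign_def shift by (simp add: card_image)
qed

text \<open>The self-similarity of the centroid map on which the inductions below rest: a leading
  \<open>qe\<close> enters the sign count of every later position.\<close>

lemma centroid_Cons:
  "centroid d (a # b) = d *\<^sub>R dir a + (if a = qe then - 1 else 1) *\<^sub>R centroid (d / 2) b"
  unfolding centroid_def length_Cons sum.lessThan_Suc_shift
  by (simp add: alt_sign_0 alt_sign_Cons_Suc scaleR_sum_right mult.assoc sum_negf)

text \<open>The strict bound is what lets a single letter outweigh all that follow it.\<close>

lemma norm_centroid_less:
  assumes "d > 0"
  shows "norm (centroid d b) < 2 * d"
  using assms
proof (induction b arbitrary: d)
  case Nil
  then show ?case by (simp add: centroid_def)
next
  case (Cons a b)
  have "norm (centroid d (a # b)) \<le> norm (d *\<^sub>R dir a) + norm (centroid (d / 2) b)"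
    unfolding centroid_Cons by (rule norm_triangle_le) simp
  moreover have "norm (d *\<^sub>R dir a) \<le> d"
    using Cons.prems by (simp add: norm_dir)
  moreover have "norm (centroid (d / 2) b) < d"
    using Cons.IH[of "d / 2"] Cons.prems by simp
  ultimately show ?case by linarith
qed

lemma centroid_eq_0_iff:
  assumes "d > 0"
  shows "centroid d b = 0 \<longleftrightarrow> b = id_word (length b)"
  using assms
proof (induction b arbitrary: d)
  case Nil
  then show ?case by (simp add: centroid_def id_word_def)
next
  case (Cons a b)
  show ?case
  proof (cases "a = qe")
    case True
    then show ?thesis
      using Cons.IH[of "d / 2"] Cons.prems
      by (simp add: centroid_Cons id_word_def zero_prod_def[symmetric])
  next
    case False
    have "norm (centroid (d / 2) b) < norm (d *\<^sub>R dir a)"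
      using norm_centroid_less[of "d / 2" b] Cons.prems False by (simp add: norm_dir)
    then have "d *\<^sub>R dir a + centroid (d / 2) b \<noteq> 0"
      by (metis add_eq_0_iff norm_minus_cancel order_less_irrefl)
    then show ?thesis using False by (simp add: centroid_Cons id_word_def)
  qed
qed

text \<open>Up to sign every word is its own inverse, because every letter is.\<close>

lemma product_eq_id_word_iff:
  assumes "b \<in> words n" "c \<in> words n" "w \<in> words n"
  shows "unsign (pos b \<odot> pos c \<odot> pos w) = id_word n \<longleftrightarrow> w = unsign (pos b \<odot> pos c)"
proof -
  have letters: "snd (lmult (snd (lmult x y)) z) = qe \<longleftrightarrow> z = snd (lmult x y)" for x y z
    by (cases x; cases y; cases z; simp)
  have "length b = length c" "length c = length w" and n: "n = length b"
    using assms by (simp_all add: words_def)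
  then show ?thesis
    unfolding n
    by (induction b c w rule: list_induct3) (simp_all add: pos_def unsign_def id_word_def letters)
qed

lemma unsign_product_in_words:
  "b \<in> words n \<Longrightarrow> c \<in> words n \<Longrightarrow> unsign (pos b \<odot> pos c) \<in> words n"
  by (simp add: words_def pos_def unsign_def)

lemma prod_word_in_words:
  assumes "b1 \<in> words n" "b2 \<in> words n" "b3 \<in> words n" "distinct [b1, b2, b3]"
  shows "prod_word {b1, b2, b3} \<in> words n"
  unfolding prod_word_eq[OF assms] using assms by (simp add: words_def pos_def unsign_def)

lemma mult_generated_iff_prod_word:
  assumes "b1 \<in> words n" "b2 \<in> words n" "b3 \<in> words n" "distinct [b1, b2, b3]"
  shows "mult_generated n {b1, b2, b3} \<longleftrightarrow> prod_word {b1, b2, b3} = id_word n"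
proof
  assume "mult_generated n {b1, b2, b3}"
  then obtain b c where bc: "b \<in> words n" "c \<in> words n"
    and T: "{b1, b2, b3} = {b, c, unsign (pos b \<odot> pos c)}"
    unfolding mult_generated_def by blast
  let ?w = "unsign (pos b \<odot> pos c)"
  have w: "?w \<in> words n" by (rule unsign_product_in_words[OF bc])
  \<comment> \<open>The triple has three elements, so its generating presentation has no repetition either.\<close>
  have "card {b, c, ?w} = 3"
    unfolding T[symmetric] using assms(4) by simp
  then have "distinct [b, c, ?w]"
    by (intro card_distinct) simp
  then show "prod_word {b1, b2, b3} = id_word n"
    unfolding T using prod_word_eq[OF bc w] product_eq_id_word_iff[OF bc w] by simp
next
  assume "prod_word {b1, b2, b3} = id_word n"
  then have "b3 = unsign (pos b1 \<odot> pos b2)"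
    using prod_word_eq[OF assms] product_eq_id_word_iff[OF assms(1-3)] by simp
  then show "mult_generated n {b1, b2, b3}"
    unfolding mult_generated_def using assms(1,2) by blast
qed

theorem proposition9p2:
  fixes n :: nat and d1 :: real
  assumes "n \<ge> 1" and "d1 > 0"
  shows "(\<forall>T \<in> eq_triples d1 n.
            (mult_generated n T \<longleftrightarrow> prod_word T = id_word n) \<and>
            (prod_word T = id_word n \<longleftrightarrow> product_point d1 T = 0)) \<and>
         mult_triples d1 n = {T \<in> eq_triples d1 n. prod_word T = id_word n} \<and>
         mult_triples d1 n = {T \<in> eq_triples d1 n. product_point d1 T = 0}"
proof -
  have equivalences: "(mult_generated n T \<longleftrightarrow> prod_word T = id_word n) \<and>
      (prod_word T = id_word n \<longleftrightarrow> product_point d1 T = 0)" if "T \<in> eq_triples d1 n" for T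
  proof -
    obtain b1 b2 b3 where b: "b1 \<in> words n" "b2 \<in> words n" "b3 \<in> words n" "distinct [b1, b2, b3]"
      and T: "T = {b1, b2, b3}"
      using \<open>T \<in> eq_triples d1 n\<close> unfolding eq_triples_def by blast
    have "length (prod_word T) = n"
      using prod_word_in_words[OF b] by (simp add: T words_def)
    then show ?thesis
      using mult_generated_iff_prod_word[OF b] centroid_eq_0_iff[OF \<open>d1 > 0\<close>, of "prod_word T"]
      by (simp add: T product_point_def)
  qed
  then show ?thesis unfolding mult_triples_def by blast
qed

end
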